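(* Let $X$ be a real Banach space with $\dim X\ge 2$ and let $-\infty\le t<\infty$. Then $$C_t^B(X)=2\quad\Longleftrightarrow\quad X\text{ is not uniformly non-square}.$$ Consequently, $$C_t^B(X)<2\quad\Longleftrightarrow\quad X\text{ is uniformly non-square}.$$
   Context: $S_X$ denotes the unit sphere of $X$. For $x,y\in X$, Birkhoff-James orthogonality $x\perp_B y$ means $\|x+\lambda y\|\ge\|x\|$ for all $\lambda\in\mathbb{R}$. For $a,b>0$ set $M_t(a,b)=\left(\frac{a^t+b^t}{2}\right)^{1/t}$ if $t\in\mathbb{R}\setminus\{0\}$, $M_0(a,b)=\sqrt{ab}$, and $M_{-\infty}(a,b)=\min\{a,b\}$. For $-\infty\le t<\infty$ and $\tau\ge 0$ define $$J^B_{X,t}(\tau)=\sup\{M_t(\|x+\tau y\|,\|x-\tau y\|): x,y\in S_X,\ x\perp_B y\},\qquad C^B_t(X)=\sup_{0\le\tau\le1}\frac{J^B_{X,t}(\tau)^2}{1+\tau^2}.$$ $X$ is uniformly non-square if there exists $\delta>0$ such that for all $x,y\in S_X$ at least one of $\frac{\|x+y\|}{2}\le1-\delta$, $\frac{\|x-y\|}{2}\le1-\delta$ holds. *)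

theory Defs
  imports "HOL-Analysis.Analysis" "HOL-Library.Extended_Real"
begin

definition birkhoff_james_orthogonal :: "'a::real_normed_vector \<Rightarrow> 'a \<Rightarrow> bool" where
  "birkhoff_james_orthogonal x y \<longleftrightarrow> (\<forall>l::real. norm (x + l *\<^sub>R y) \<ge> norm x)"

(* The order is an extended real t < \<infinity>; the clause for \<infinity> only makes the function total. *)
definition power_mean :: "ereal \<Rightarrow> real \<Rightarrow> real \<Rightarrow> real" where
  "power_mean t a b = (case t of
       ereal r \<Rightarrow> (if r = 0 then sqrt (a * b) else ((a powr r + b powr r) / 2) powr (1 / r))
     | MInfty \<Rightarrow> min a b
     | PInfty \<Rightarrow> max a b)"

(* Orthogonality of unit vectors x, y gives 1 \<le> norm (x + \<tau> y), norm (x - \<tau> y) \<le> 1 + \<tau>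
   for \<tau> \<ge> 0, so the means are taken of positive numbers and the set below is bounded.
   It is nonempty as soon as the space has dimension at least 2. The same bound gives
   J \<tau>^2 / (1 + \<tau>^2) \<le> 2 in the next definition, so both suprema are genuine in \<real>. *)
definition J_BJ :: "'a::real_normed_vector itself \<Rightarrow> ereal \<Rightarrow> real \<Rightarrow> real" where
  "J_BJ X t \<tau> = Sup {power_mean t (norm (x + \<tau> *\<^sub>R y)) (norm (x - \<tau> *\<^sub>R y)) | x y :: 'a.
      x \<in> sphere 0 1 \<and> y \<in> sphere 0 1 \<and> birkhoff_james_orthogonal x y}"

definition C_BJ :: "'a::real_normed_vector itself \<Rightarrow> ereal \<Rightarrow> real" where
  "C_BJ X t = (SUP \<tau>\<in>{0..1}. (J_BJ X t \<tau>)\<^sup>2 / (1 + \<tau>\<^sup>2))"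

definition uniformly_non_square :: "'a::real_normed_vector itself \<Rightarrow> bool" where
  "uniformly_non_square X \<longleftrightarrow> (\<exists>\<delta>>0. \<forall>x\<in>sphere (0::'a) 1. \<forall>y\<in>sphere 0 1.
      norm (x + y) / 2 \<le> 1 - \<delta> \<or> norm (x - y) / 2 \<le> 1 - \<delta>)"

end

theory Submission
  imports Defs
begin

text \<open>
  Orthogonality bounds both norms by \<open>1 + \<tau>\<close>, so the constant is at most 2, and it can only
  be 2 through parameters near \<open>\<tau> = 1\<close> with both norms close to 2, which uniform
  non-squareness forbids. Conversely, if unit vectors \<open>x\<close>, \<open>y\<close> satisfy
  \<open>\<parallel>x \<plusminus> y\<parallel> > 2 - \<epsilon>\<close>, then the minimiser \<open>l\<close> of \<open>\<parallel>x + l y\<parallel>\<close> satisfies \<open>\<bar>l\<bar> \<le> \<epsilon>\<close>; hence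
  \<open>x\<close> can be replaced, at the cost of \<open>2 \<epsilon>\<close>, by a unit vector orthogonal to \<open>y\<close>, and the
  value at \<open>\<tau> = 1\<close> is already 2 for every mean, since a mean dominates the minimum.
\<close>

section \<open>Power means: monotonicity, strictness and comparison with constants\<close>

lemma power_mean_commute: "power_mean t a b = power_mean t b a"
  by (cases t) (auto simp: power_mean_def mult.commute add.commute min.commute max.commute)

lemma power_mean_same: "power_mean t a a = a" if "a > 0"
  using that by (cases t) (auto simp: power_mean_def powr_powr)

lemma power_mean_mono:
  assumes "0 < a" "0 < b" "a \<le> a'" "b \<le> b'"
  shows "power_mean t a b \<le> power_mean t a' b'"
proof (cases t)
  case (real r)
  consider "r = 0" | "r > 0" | "r < 0" by linarith
  then show ?thesis
  proof cases
    case 1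
    then show ?thesis using real assms by (auto simp: power_mean_def intro!: mult_mono)
  next
    case 2
    have "a powr r \<le> a' powr r" "b powr r \<le> b' powr r"
      using assms 2 by (auto intro!: powr_mono2)
    then have "((a powr r + b powr r) / 2) powr (1 / r) \<le> ((a' powr r + b' powr r) / 2) powr (1 / r)"
      using 2 by (intro powr_mono2) auto
    then show ?thesis using real 2 by (simp add: power_mean_def)
  next
    case 3
    have "a' powr r \<le> a powr r" "b' powr r \<le> b powr r"
      using assms 3 by (auto intro!: powr_mono2')
    moreover have "0 < a' powr r + b' powr r" using assms by (intro add_pos_pos) auto
    ultimately have "((a powr r + b powr r) / 2) powr (1 / r) \<le> ((a' powr r + b' powr r) / 2) powr (1 / r)"
      using 3 by (intro powr_mono2') auto
    then show ?thesis using real 3 by (simp add: power_mean_def)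
  qed
qed (use assms in \<open>auto simp: power_mean_def\<close>)

text \<open>The hypothesis \<open>t < \<infinity>\<close> enters here: for the maximum the value
  would be \<open>a\<close> itself. The strict inequality later keeps the mean of 2 and some
  \<open>c < 2\<close> away from 2.\<close>

lemma power_mean_less:
  assumes "0 < b" "b < a" "t < \<infinity>"
  shows "power_mean t a b < a"
proof (cases t)
  case (real r)
  consider "r = 0" | "r > 0" | "r < 0" by linarith
  then show ?thesis
  proof cases
    case 1
    have "sqrt (a * b) < sqrt (a * a)" using assms by (intro real_sqrt_less_mono) auto
    then show ?thesis using real 1 assms by (simp add: power_mean_def)
  next
    case 2
    have "b powr r < a powr r" using assms 2 by (intro powr_less_mono2) auto
    then have "((a powr r + b powr r) / 2) powr (1 / r) < (a powr r) powr (1 / r)"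
      using 2 by (intro powr_less_mono2) auto
    then show ?thesis using real 2 assms by (simp add: power_mean_def powr_powr)
  next
    case 3
    have "a powr r < b powr r" using assms 3 by (intro powr_less_mono2_neg) auto
    moreover have "0 < a powr r" using assms by auto
    ultimately have "((a powr r + b powr r) / 2) powr (1 / r) < (a powr r) powr (1 / r)"
      using 3 by (intro powr_less_mono2_neg) auto
    then show ?thesis using real 3 assms by (simp add: power_mean_def powr_powr)
  qed
qed (use assms in \<open>auto simp: power_mean_def\<close>)

lemma power_mean_le:
  assumes "0 < a" "0 < b" "a \<le> c" "b \<le> c"
  shows "power_mean t a b \<le> c"
  using power_mean_mono[OF assms, of t] power_mean_same[of c t] assms by simp

lemma power_mean_ge:
  assumes "0 < c" "c \<le> a" "c \<le> b"
  shows "c \<le> power_mean t a b"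
  using power_mean_mono[of c c a b t] power_mean_same[of c t] assms by simp

section \<open>Birkhoff-James orthogonality: existence and norm bounds\<close>

lemma birkhoff_james_orthogonal_scaleR:
  assumes "birkhoff_james_orthogonal x y"
  shows "birkhoff_james_orthogonal (a *\<^sub>R x) (b *\<^sub>R y)"
  unfolding birkhoff_james_orthogonal_def
proof
  fix l :: real
  show "norm (a *\<^sub>R x) \<le> norm (a *\<^sub>R x + l *\<^sub>R b *\<^sub>R y)"
  proof (cases "a = 0")
    case False
    have "a *\<^sub>R x + l *\<^sub>R b *\<^sub>R y = a *\<^sub>R (x + (l * b / a) *\<^sub>R y)"
      using False by (simp add: algebra_simps)
    then show ?thesis
      using assms unfolding birkhoff_james_orthogonal_def
      by (metis norm_scaleR abs_ge_zero mult_left_mono)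
  qed simp
qed

text \<open>A global minimiser of the continuous function \<open>norm (x + l *\<^sub>R y)\<close> of
  \<open>l\<close> gives the orthogonal vector; it exists because the function is coercive when
  \<open>y\<close> is nonzero.\<close>

lemma birkhoff_james_orthogonal_exists:
  fixes x y :: "'a::real_normed_vector"
  assumes "y \<noteq> 0"
  shows "\<exists>l. birkhoff_james_orthogonal (x + l *\<^sub>R y) y"
proof -
  \<comment> \<open>With this radius, \<open>f m >= norm x = f 0\<close> whenever \<open>m\<close>
    lies outside \<open>{-R..R}\<close>, so a minimum over the compact interval is global.\<close>
  define R where "R = 2 * norm x / norm y"
  define f where "f = (\<lambda>l. norm (x + l *\<^sub>R y))"
  have R: "R \<ge> 0" by (simp add: R_def)
  have "continuous_on {-R..R} f" unfolding f_def by (intro continuous_intros)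
  then obtain l where l: "\<forall>m\<in>{-R..R}. f l \<le> f m"
    using continuous_attains_inf[of "{-R..R}" f] R by auto
  have "f l \<le> f m" for m
  proof (cases "m \<in> {-R..R}")
    case False
    then have "R \<le> \<bar>m\<bar>" by auto
    then have "2 * norm x \<le> \<bar>m\<bar> * norm y"
      using assms by (simp add: R_def pos_divide_le_eq)
    also have "\<dots> = norm ((x + m *\<^sub>R y) - x)" by simp
    also have "\<dots> \<le> f m + norm x" unfolding f_def by (rule norm_triangle_ineq4)
    finally have "f 0 \<le> f m" by (simp add: f_def)
    moreover have "f l \<le> f 0" using l R by simp
    ultimately show ?thesis by simp
  qed (use l in auto)
  then have "norm (x + l *\<^sub>R y) \<le> norm (x + l *\<^sub>R y + m *\<^sub>R y)" for m
    using f_def by (metis add.assoc scaleR_add_left)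
  then show ?thesis unfolding birkhoff_james_orthogonal_def by blast
qed

lemma birkhoff_james_orthogonal_norm_ge:
  assumes "birkhoff_james_orthogonal x y"
  shows "norm x \<le> norm (x + l *\<^sub>R y)" "norm x \<le> norm (x - l *\<^sub>R y)"
proof -
  show "norm x \<le> norm (x + l *\<^sub>R y)"
    using assms by (simp add: birkhoff_james_orthogonal_def)
  have "norm x \<le> norm (x + (- l) *\<^sub>R y)"
    using assms unfolding birkhoff_james_orthogonal_def by blast
  then show "norm x \<le> norm (x - l *\<^sub>R y)" by simp
qed

text \<open>Independence keeps \<open>x + l *\<^sub>R y\<close> away from 0, so it can be
  normalised. The pair makes the set in the definition of \<open>J_BJ\<close> nonempty.\<close>

lemma orthogonal_unit_pair_exists:
  assumes "\<exists>B :: 'a::real_normed_vector set. independent B \<and> card B = 2"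
  shows "\<exists>x y :: 'a. norm x = 1 \<and> norm y = 1 \<and> birkhoff_james_orthogonal x y"
proof -
  obtain x y :: 'a where xy: "independent {x, y}" "x \<noteq> y"
    using assms card_2_iff by metis
  have y: "y \<noteq> 0" using xy(1) dependent_zero by auto
  obtain l where l: "birkhoff_james_orthogonal (x + l *\<^sub>R y) y"
    using birkhoff_james_orthogonal_exists[OF y] by blast
  have "x \<notin> span {y}" using xy by (auto simp: independent_insert)
  moreover have "x \<in> span {y}" if "x + l *\<^sub>R y = 0"
  proof -
    have "x = (- l) *\<^sub>R y" using that by (simp add: eq_neg_iff_add_eq_0)
    then show ?thesis by (metis span_base span_scale singletonI)
  qed
  ultimately have "x + l *\<^sub>R y \<noteq> 0" by blast
  then have "norm (sgn (x + l *\<^sub>R y)) = 1" "norm (sgn y) = 1"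
    using y by (simp_all add: norm_sgn)
  moreover have "birkhoff_james_orthogonal (sgn (x + l *\<^sub>R y)) (sgn y)"
    unfolding sgn_div_norm by (intro birkhoff_james_orthogonal_scaleR l)
  ultimately show ?thesis by blast
qed

section \<open>Replacing an almost square pair by an orthogonal one\<close>

lemma minimiser_small_nonneg:
  assumes "norm x = 1" "norm y = 1" "2 - e < norm (x + y)" "e < 1"
    "norm (x + l *\<^sub>R y) \<le> 1" "0 \<le> l"
  shows "l \<le> e"
proof (cases "l \<le> 1")
  case True
  \<comment> \<open>This splitting bounds \<open>norm (x + y)\<close> by \<open>1 + (1 - l)\<close>,
    to be compared with \<open>2 - e\<close>.\<close>
  have "x + y = (x + l *\<^sub>R y) + (1 - l) *\<^sub>R y" by (simp add: algebra_simps)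
  then have "norm (x + y) \<le> norm (x + l *\<^sub>R y) + norm ((1 - l) *\<^sub>R y)"
    by (metis norm_triangle_ineq)
  then show ?thesis using assms True by simp
next
  case False
  \<comment> \<open>For \<open>l > 1\<close> this is a convex combination of two points of the unit
    ball, so \<open>norm (x + y) <= 1\<close>, which contradicts \<open>2 - e > 1\<close>.\<close>
  have "x + y = (1 / l) *\<^sub>R (x + l *\<^sub>R y) + (1 - 1 / l) *\<^sub>R x"
    using False by (simp add: algebra_simps)
  then have "norm (x + y) \<le> norm ((1 / l) *\<^sub>R (x + l *\<^sub>R y)) + norm ((1 - 1 / l) *\<^sub>R x)"
    by (metis norm_triangle_ineq)
  also have "\<dots> \<le> 1 / l + (1 - 1 / l)"
    using False assms by (intro add_mono) (auto simp: divide_simps)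
  finally show ?thesis using assms by simp
qed

lemma minimiser_small:
  assumes "norm x = 1" "norm y = 1" "2 - e < norm (x + y)" "2 - e < norm (x - y)" "e < 1"
    "norm (x + l *\<^sub>R y) \<le> 1"
  shows "\<bar>l\<bar> \<le> e"
  using minimiser_small_nonneg[of x y e l] minimiser_small_nonneg[of x "- y" e "- l"] assms
  by (cases "0 \<le> l") auto

text \<open>The loss of \<open>3 * e\<close> consists of \<open>e\<close> from the hypothesis,
  \<open>e\<close> for moving \<open>x\<close> to the orthogonal vector \<open>z\<close>, and
  \<open>e\<close> for normalising \<open>z\<close>.\<close>

lemma almost_square_orthogonal:
  fixes x y :: "'a::real_normed_vector"
  assumes "norm x = 1" "norm y = 1" "2 - e < norm (x + y)" "2 - e < norm (x - y)" "e < 1"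
  shows "\<exists>u. norm u = 1 \<and> birkhoff_james_orthogonal u y \<and>
    2 - 3 * e \<le> norm (u + y) \<and> 2 - 3 * e \<le> norm (u - y)"
proof -
  have "y \<noteq> 0" using assms by auto
  then obtain l where l: "birkhoff_james_orthogonal (x + l *\<^sub>R y) y"
    using birkhoff_james_orthogonal_exists by blast
  define z where "z = x + l *\<^sub>R y"
  have "norm z \<le> 1"
    using birkhoff_james_orthogonal_norm_ge(2)[OF l, of l] assms by (simp add: z_def)
  then have le: "\<bar>l\<bar> \<le> e" using minimiser_small assms unfolding z_def by blast
  have xz: "norm (x - z) \<le> e" using le assms by (simp add: z_def)
  have "norm x \<le> norm (x - z) + norm z"
    using norm_triangle_ineq[of "x - z" z] by simp
  then have z1: "1 - e \<le> norm z" using xz assms by simp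
  then have z0: "z \<noteq> 0" using assms by auto
  \<comment> \<open>Normalising moves \<open>z\<close> by exactly \<open>1 - norm z\<close>, and
    \<open>norm z\<close> lies between \<open>1 - e\<close> and 1.\<close>
  have "z - sgn z = (norm z - 1) *\<^sub>R sgn z"
    using z0 by (simp add: sgn_div_norm algebra_simps)
  then have "norm (z - sgn z) \<le> e" using z0 z1 \<open>norm z \<le> 1\<close> by (simp add: norm_sgn)
  then have d: "norm (x - sgn z) \<le> 2 * e"
    using xz norm_triangle_ineq[of "x - z" "z - sgn z"] by simp
  have "norm (x + y) \<le> norm (x - sgn z) + norm (sgn z + y)"
    using norm_triangle_ineq[of "x - sgn z" "sgn z + y"] by simp
  moreover have "norm (x - y) \<le> norm (x - sgn z) + norm (sgn z - y)"
    using norm_triangle_ineq[of "x - sgn z" "sgn z - y"] by simp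
  moreover have "birkhoff_james_orthogonal (sgn z) y"
    using birkhoff_james_orthogonal_scaleR[OF l, of "inverse (norm z)" 1]
    by (simp add: sgn_div_norm z_def)
  moreover have "norm (sgn z) = 1" using z0 by (simp add: norm_sgn)
  ultimately show ?thesis using d assms by (intro exI[of _ "sgn z"]) auto
qed

section \<open>Bounds for \<open>J_BJ\<close> and \<open>C_BJ\<close>\<close>

lemma norm_add_scaleR_bounds:
  assumes "norm x = 1" "norm y = 1" "birkhoff_james_orthogonal x y" "0 \<le> \<tau>"
  shows "1 \<le> norm (x + \<tau> *\<^sub>R y)" "norm (x + \<tau> *\<^sub>R y) \<le> 1 + \<tau>"
    "1 \<le> norm (x - \<tau> *\<^sub>R y)" "norm (x - \<tau> *\<^sub>R y) \<le> 1 + \<tau>"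
  using birkhoff_james_orthogonal_norm_ge[OF assms(3), of \<tau>]
    norm_triangle_ineq[of x "\<tau> *\<^sub>R y"] norm_triangle_ineq4[of x "\<tau> *\<^sub>R y"] assms
  by auto

lemma J_BJ_upper:
  fixes x y :: "'a::real_normed_vector"
  assumes "norm x = 1" "norm y = 1" "birkhoff_james_orthogonal x y" "0 \<le> \<tau>"
  shows "power_mean t (norm (x + \<tau> *\<^sub>R y)) (norm (x - \<tau> *\<^sub>R y)) \<le> J_BJ TYPE('a) t \<tau>"
  unfolding J_BJ_def
proof (rule cSup_upper)
  show "bdd_above {power_mean t (norm (x + \<tau> *\<^sub>R y)) (norm (x - \<tau> *\<^sub>R y)) | x y :: 'a.
      x \<in> sphere 0 1 \<and> y \<in> sphere 0 1 \<and> birkhoff_james_orthogonal x y}"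
  proof (rule bdd_aboveI, clarsimp)
    fix x y :: 'a
    assume "norm x = 1" "norm y = 1" "birkhoff_james_orthogonal x y"
    from norm_add_scaleR_bounds[OF this assms(4)]
    show "power_mean t (norm (x + \<tau> *\<^sub>R y)) (norm (x - \<tau> *\<^sub>R y)) \<le> 1 + \<tau>"
      by (intro power_mean_le) auto
  qed
qed (use assms in auto)

lemma J_BJ_least:
  assumes "\<exists>B :: 'a::real_normed_vector set. independent B \<and> card B = 2"
    and "\<And>x y :: 'a. norm x = 1 \<Longrightarrow> norm y = 1 \<Longrightarrow> birkhoff_james_orthogonal x y \<Longrightarrow>
      power_mean t (norm (x + \<tau> *\<^sub>R y)) (norm (x - \<tau> *\<^sub>R y)) \<le> c"
  shows "J_BJ TYPE('a) t \<tau> \<le> c"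
  unfolding J_BJ_def
  using orthogonal_unit_pair_exists[OF assms(1)] assms(2) by (intro cSup_least) auto

lemma J_BJ_bounds:
  assumes "\<exists>B :: 'a::real_normed_vector set. independent B \<and> card B = 2" "0 \<le> \<tau>"
  shows "1 \<le> J_BJ TYPE('a) t \<tau>" "J_BJ TYPE('a) t \<tau> \<le> 1 + \<tau>"
proof -
  obtain x y :: 'a where xy: "norm x = 1" "norm y = 1" "birkhoff_james_orthogonal x y"
    using orthogonal_unit_pair_exists[OF assms(1)] by blast
  have "1 \<le> power_mean t (norm (x + \<tau> *\<^sub>R y)) (norm (x - \<tau> *\<^sub>R y))"
    using norm_add_scaleR_bounds[OF xy assms(2)] by (intro power_mean_ge) auto
  also have "\<dots> \<le> J_BJ TYPE('a) t \<tau>" by (rule J_BJ_upper[OF xy assms(2)])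
  finally show "1 \<le> J_BJ TYPE('a) t \<tau>" .
  show "J_BJ TYPE('a) t \<tau> \<le> 1 + \<tau>"
  proof (rule J_BJ_least[OF assms(1)])
    fix x y :: 'a
    assume "norm x = 1" "norm y = 1" "birkhoff_james_orthogonal x y"
    from norm_add_scaleR_bounds[OF this assms(2)]
    show "power_mean t (norm (x + \<tau> *\<^sub>R y)) (norm (x - \<tau> *\<^sub>R y)) \<le> 1 + \<tau>"
      by (intro power_mean_le) auto
  qed
qed

lemma power2_one_plus_div_le: "(1 + \<tau>)\<^sup>2 / (1 + \<tau>\<^sup>2) \<le> (2::real)"
  using zero_le_power2[of "1 - \<tau>"]
  by (simp add: pos_divide_le_eq add_pos_nonneg power2_eq_square algebra_simps)

lemma J_BJ_quotient_le:
  assumes "\<exists>B :: 'a::real_normed_vector set. independent B \<and> card B = 2" "0 \<le> \<tau>"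
  shows "(J_BJ TYPE('a) t \<tau>)\<^sup>2 / (1 + \<tau>\<^sup>2) \<le> 2"
proof -
  have "(J_BJ TYPE('a) t \<tau>)\<^sup>2 / (1 + \<tau>\<^sup>2) \<le> (1 + \<tau>)\<^sup>2 / (1 + \<tau>\<^sup>2)"
    using J_BJ_bounds[OF assms, of t] by (intro divide_right_mono power_mono) auto
  also have "\<dots> \<le> 2" by (rule power2_one_plus_div_le)
  finally show ?thesis .
qed

lemma C_BJ_le_2:
  assumes "\<exists>B :: 'a::real_normed_vector set. independent B \<and> card B = 2"
  shows "C_BJ TYPE('a) t \<le> 2"
  unfolding C_BJ_def using J_BJ_quotient_le[OF assms] by (intro cSUP_least) auto

section \<open>Uniform non-squareness forces a constant below 2\<close>

lemma norm_add_scaleR_le: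
  assumes "norm x = 1" "norm (x + y) \<le> c" "1 \<le> c" "0 \<le> \<tau>" "\<tau> \<le> 1"
  shows "norm (x + \<tau> *\<^sub>R y) \<le> c"
proof -
  \<comment> \<open>The point lies on the segment from \<open>x\<close> to \<open>x + y\<close>, and
    balls are convex; thus a bound at parameter 1 passes to all smaller ones.\<close>
  have "x + \<tau> *\<^sub>R y = (1 - \<tau>) *\<^sub>R x + \<tau> *\<^sub>R (x + y)" by (simp add: algebra_simps)
  moreover have "x \<in> cball 0 c" "x + y \<in> cball 0 c" using assms by auto
  ultimately have "x + \<tau> *\<^sub>R y \<in> cball 0 c"
    using convexD_alt[OF convex_cball] assms by metis
  then show ?thesis by simp
qed

text \<open>Two bounds on \<open>J_BJ\<close> cooperate: \<open>1 + \<tau>\<close> keeps the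
  quotient below 2 for \<open>\<tau> < 1\<close>, and a constant \<open>q < 2\<close> does so at 1.
  Compactness turns these pointwise gaps into a gap for the supremum.\<close>

lemma uniformly_non_square_imp_C_BJ_less:
  assumes dim: "\<exists>B :: 'a::real_normed_vector set. independent B \<and> card B = 2"
    and t: "t < \<infinity>" and uns: "uniformly_non_square TYPE('a)"
  shows "C_BJ TYPE('a) t < 2"
proof -
  obtain \<delta> where \<delta>: "\<delta> > 0"
    "\<And>x y :: 'a. norm x = 1 \<Longrightarrow> norm y = 1 \<Longrightarrow> norm (x + y) / 2 \<le> 1 - \<delta> \<or> norm (x - y) / 2 \<le> 1 - \<delta>"
    using uns unfolding uniformly_non_square_def by auto
  \<comment> \<open>The maximum with 1 makes the ball of radius \<open>c\<close> contain the unit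
    vector \<open>x\<close>, and keeps \<open>c\<close> positive even for large \<delta>.\<close>
  define c where "c = max 1 (2 - 2 * \<delta>)"
  \<comment> \<open>One of the two norms will be at most \<open>c\<close>, the other at most
    \<open>1 + \<tau> <= 2\<close>.\<close>
  define q where "q = power_mean t 2 c"
  have c: "1 \<le> c" "c < 2" using \<delta>(1) by (auto simp: c_def)
  have q: "q < 2" "0 < q"
    using power_mean_less[of c 2 t] power_mean_ge[of 1 2 c t] c t by (auto simp: q_def)
  have Jq: "J_BJ TYPE('a) t \<tau> \<le> q" if \<tau>: "0 \<le> \<tau>" "\<tau> \<le> 1" for \<tau>
  proof (rule J_BJ_least[OF dim])
    fix x y :: 'a
    assume xy: "norm x = 1" "norm y = 1" "birkhoff_james_orthogonal x y"
    note b = norm_add_scaleR_bounds[OF xy \<tau>(1)]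
    consider "norm (x + y) \<le> c" | "norm (x + - y) \<le> c"
      using \<delta>(2)[OF xy(1,2)] by (auto simp: c_def)
    then show "power_mean t (norm (x + \<tau> *\<^sub>R y)) (norm (x - \<tau> *\<^sub>R y)) \<le> q"
    proof cases
      case 1
      have "norm (x + \<tau> *\<^sub>R y) \<le> c" using norm_add_scaleR_le[OF xy(1) 1 c(1) \<tau>] .
      then show ?thesis
        unfolding q_def power_mean_commute[of t 2 c] using b \<tau> by (intro power_mean_mono) auto
    next
      case 2
      have "norm (x - \<tau> *\<^sub>R y) \<le> c" using norm_add_scaleR_le[OF xy(1) 2 c(1) \<tau>] by simp
      then show ?thesis
        unfolding q_def using b \<tau> by (intro power_mean_mono) auto
    qed
  qed
  \<comment> \<open>A continuous majorant of the quotient: unlike the quotient, whose continuity is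
    not established, it is known to attain its maximum on \<open>{0..1}\<close>.\<close>
  define f where "f = (\<lambda>\<tau>::real. (min (1 + \<tau>) q)\<^sup>2 / (1 + \<tau>\<^sup>2))"
  have pos: "0 < 1 + \<tau>\<^sup>2" for \<tau> :: real by (simp add: add_pos_nonneg)
  have "continuous_on {0..1} f"
    unfolding f_def using pos by (intro continuous_intros ballI) (metis less_irrefl)
  then obtain s where s: "s \<in> {0..1}" "\<And>\<tau>. \<tau> \<in> {0..1} \<Longrightarrow> f \<tau> \<le> f s"
    using continuous_attains_sup[of "{0..1}" f] by auto
  have "(min (1 + s) q)\<^sup>2 < 2 * (1 + s\<^sup>2)"
  proof (cases "s = 1")
    case True
    have "q\<^sup>2 < 2\<^sup>2" using q by (intro power_strict_mono) auto
    then show ?thesis using True q by (simp add: min_def)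
  next
    case False
    have "(min (1 + s) q)\<^sup>2 \<le> (1 + s)\<^sup>2" using s q by (intro power_mono) auto
    \<comment> \<open>The difference of the two sides is \<open>(1 - s)\<^sup>2\<close>.\<close>
    also have "\<dots> < 2 * (1 + s\<^sup>2)"
      using False zero_less_power2[of "1 - s"] by (simp add: power2_eq_square algebra_simps)
    finally show ?thesis .
  qed
  then have "f s < 2" unfolding f_def using pos by (simp add: pos_divide_less_eq)
  moreover have "C_BJ TYPE('a) t \<le> f s"
    unfolding C_BJ_def
  proof (rule cSUP_least)
    fix \<tau> :: real assume \<tau>: "\<tau> \<in> {0..1}"
    have "(J_BJ TYPE('a) t \<tau>)\<^sup>2 / (1 + \<tau>\<^sup>2) \<le> f \<tau>"
      unfolding f_def using J_BJ_bounds[OF dim, of \<tau> t] Jq[of \<tau>] \<tau>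
      by (intro divide_right_mono power_mono) auto
    also have "\<dots> \<le> f s" using s \<tau> by blast
    finally show "(J_BJ TYPE('a) t \<tau>)\<^sup>2 / (1 + \<tau>\<^sup>2) \<le> f s" .
  qed simp
  ultimately show ?thesis by simp
qed

section \<open>Failure of uniform non-squareness forces the value 2\<close>

lemma not_uniformly_non_square_imp_J_BJ_1:
  assumes "\<not> uniformly_non_square TYPE('a::real_normed_vector)"
  shows "2 \<le> J_BJ TYPE('a) t 1"
proof (rule field_le_epsilon)
  fix d :: real assume d: "0 < d"
  \<comment> \<open>\<open>d / 3\<close> pays for the loss of \<open>3 * e\<close> in
    \<open>almost_square_orthogonal\<close>; \<open>1 / 2\<close> ensures \<open>e < 1\<close> and
    keeps the lower bound \<open>2 - 3 * e\<close> positive, as \<open>power_mean_ge\<close>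
    requires.\<close>
  define e where "e = min (d / 3) (1 / 2)"
  have e: "0 < e / 2" "e < 1" "3 * e \<le> d" "3 * e < 2" using d by (auto simp: e_def min_def)
  \<comment> \<open>Non-squareness is negated at \<open>e / 2\<close>, since the definition halves
    the norms: both norms then exceed \<open>2 - e\<close>.\<close>
  obtain x y :: 'a where xy: "norm x = 1" "norm y = 1"
    "\<not> norm (x + y) / 2 \<le> 1 - e / 2" "\<not> norm (x - y) / 2 \<le> 1 - e / 2"
    using assms e(1) unfolding uniformly_non_square_def by fastforce
  obtain u where u: "norm u = 1" "birkhoff_james_orthogonal u y"
    "2 - 3 * e \<le> norm (u + y)" "2 - 3 * e \<le> norm (u - y)"
    using almost_square_orthogonal[of x y e] xy e by auto
  have "2 - 3 * e \<le> power_mean t (norm (u + 1 *\<^sub>R y)) (norm (u - 1 *\<^sub>R y))"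
    using u e by (intro power_mean_ge) auto
  also have "\<dots> \<le> J_BJ TYPE('a) t 1" using u xy by (intro J_BJ_upper) auto
  finally show "2 \<le> J_BJ TYPE('a) t 1 + d" using e by simp
qed

lemma not_uniformly_non_square_imp_C_BJ_ge:
  assumes dim: "\<exists>B :: 'a::real_normed_vector set. independent B \<and> card B = 2"
    and "\<not> uniformly_non_square TYPE('a)"
  shows "2 \<le> C_BJ TYPE('a) t"
proof -
  have "2\<^sup>2 \<le> (J_BJ TYPE('a) t 1)\<^sup>2"
    using not_uniformly_non_square_imp_J_BJ_1[OF assms(2), of t] by (intro power_mono) auto
  then have "2 \<le> (J_BJ TYPE('a) t 1)\<^sup>2 / (1 + 1\<^sup>2)" by simp
  also have "\<dots> \<le> C_BJ TYPE('a) t"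
    unfolding C_BJ_def
  proof (rule cSUP_upper)
    show "bdd_above ((\<lambda>\<tau>. (J_BJ TYPE('a) t \<tau>)\<^sup>2 / (1 + \<tau>\<^sup>2)) ` {0..1})"
      using J_BJ_quotient_le[OF dim] by (intro bdd_aboveI2) auto
  qed simp
  finally show ?thesis .
qed

theorem theorem6:
  fixes t :: ereal
  assumes "\<exists>B :: 'a::banach set. independent B \<and> card B = 2"
    and "t < \<infinity>"
  shows "(C_BJ TYPE('a) t = 2 \<longleftrightarrow> \<not> uniformly_non_square TYPE('a)) \<and>
         (C_BJ TYPE('a) t < 2 \<longleftrightarrow> uniformly_non_square TYPE('a))"
  using C_BJ_le_2[OF assms(1), of t] uniformly_non_square_imp_C_BJ_less[OF assms]
    not_uniformly_non_square_imp_C_BJ_ge[OF assms(1), of t]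
  by force

end
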